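(* For every $\delta>0$, there is $\rho>0$ such that the following holds for all sufficiently large $n$ (depending on $\delta$ and $\rho$). If $G$ is an $n$-vertex $C_8$-free graph whose number $\mathrm{N}(C_6,G)$ of copies of $C_6$ satisfies \[ \mathrm{N}(C_6,G)\ge R(n):=6\binom{n-3}{3}+12(n-5), \] then there is a triple $\{a,b,c\}$ of distinct vertices of $G$ with \[ |N(a)\cap N(b)\cap N(c)|\ge(1-\delta)n. \]
   Context: All graphs are finite, simple and undirected; $N(v)$ is the (open) neighborhood of $v$ in $G$. A graph is $C_8$-free if it has no (not necessarily induced) subgraph isomorphic to the 8-cycle. $\mathrm{N}(C_6,G)$ is the number of subgraphs of $G$ (not necessarily induced) isomorphic to the 6-cycle $C_6$. The number $\rho$ is an auxiliary parameter that does not occur in the hypothesis or conclusion on $G$; it may only influence how large $n$ must be. *)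

theory Defs
  imports Complex_Main
begin

text \<open>A graph is a pair of a vertex set and a set of edges, edges being two-element
  sets of vertices.\<close>

type_synonym 'a graph = "'a set \<times> 'a set set"

abbreviation verts :: "'a graph \<Rightarrow> 'a set" where
  "verts \<equiv> fst"

abbreviation edges :: "'a graph \<Rightarrow> 'a set set" where
  "edges \<equiv> snd"

definition simple_graph :: "'a graph \<Rightarrow> bool" where
  "simple_graph G \<longleftrightarrow> finite (verts G) \<and> (\<forall>e\<in>edges G. e \<subseteq> verts G \<and> card e = 2)"

definition neighborhood :: "'a graph \<Rightarrow> 'a \<Rightarrow> 'a set" where
  "neighborhood G v = {u \<in> verts G. {v, u} \<in> edges G}"

definition subgraph :: "'a graph \<Rightarrow> 'a graph \<Rightarrow> bool" where
  "subgraph H G \<longleftrightarrow> simple_graph H \<and> verts H \<subseteq> verts G \<and> edges H \<subseteq> edges G"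

definition graph_iso :: "'a graph \<Rightarrow> 'b graph \<Rightarrow> bool" where
  "graph_iso F H \<longleftrightarrow> (\<exists>f. bij_betw f (verts F) (verts H) \<and> edges H = (\<lambda>e. f ` e) ` edges F)"

definition cycle_graph :: "nat \<Rightarrow> nat graph" where
  "cycle_graph k = ({..<k}, {{i, Suc i mod k} | i. i < k})"

definition copies :: "'b graph \<Rightarrow> 'a graph \<Rightarrow> 'a graph set" where
  "copies F G = {H. subgraph H G \<and> graph_iso F H}"

lemma finite_copies:
  assumes "simple_graph G"
  shows "finite (copies F G)"
proof (rule finite_subset)
  show "copies F G \<subseteq> Pow (verts G) \<times> Pow (Pow (verts G))"
    unfolding copies_def subgraph_def simple_graph_def by fastforce
  show "finite (Pow (verts G) \<times> Pow (Pow (verts G)))"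
    using assms by (simp add: simple_graph_def)
qed

definition num_copies :: "'b graph \<Rightarrow> 'a graph \<Rightarrow> nat" where
  "num_copies F G = card (copies F G)"

definition free_of :: "'b graph \<Rightarrow> 'a graph \<Rightarrow> bool" where
  "free_of F G \<longleftrightarrow> \<not> (\<exists>H. subgraph H G \<and> graph_iso F H)"

text \<open>Natural-number subtraction truncates, so this is the intended value only for
  \<open>n \<ge> 5\<close>; it is used only for large \<open>n\<close>.\<close>

definition R :: "nat \<Rightarrow> nat" where
  "R n = 6 * ((n - 3) choose 3) + 12 * (n - 5)"

end

theory Submission
  imports Defs "HOL-Analysis.Convex" "HOL-Real_Asymp.Real_Asymp"
begin

text \<open>
  Call a pair of vertices fat if it has at least \<open>K\<close> common neighbours, where \<open>K\<close> is a large
  constant depending on \<open>\<delta>\<close>, and thin otherwise. In a 6-cycle \<open>v\<^sub>0 v\<^sub>1 v\<^sub>2 v\<^sub>3 v\<^sub>4 v\<^sub>5\<close> consider the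
  triangles \<open>v\<^sub>0 v\<^sub>2 v\<^sub>4\<close> and \<open>v\<^sub>1 v\<^sub>3 v\<^sub>5\<close> of second neighbours. If neither has only fat sides, then
  either two opposite pairs such as \<open>v\<^sub>0 v\<^sub>2\<close> and \<open>v\<^sub>3 v\<^sub>5\<close> are thin, or one of the triangles has exactly
  one thin side. Absence of \<open>C\<^sub>8\<close> makes the bipartite graph from \<open>N v\<close> to any set \<open>B\<close>, and the one
  from the second neighbourhood of \<open>v\<close> to the rest, have only linearly many edges; hence both kinds
  of 6-cycles number \<open>O(n\<^sup>5\<^sup>/\<^sup>2)\<close>.

  Four fat pairs forming a 4-cycle yield a \<open>C\<^sub>8\<close>, and the common neighbourhoods of sides of different fat
  triangles share at most one vertex. Picking the side \<open>e\<^sub>T\<close> of largest codegree \<open>m\<^sub>T\<close> in each fat triangle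
  \<open>T\<close>, one gets \<open>\<Sum> m\<^sub>T (m\<^sub>T - 1) \<le> n\<^sup>2\<close>. The 6-cycles through \<open>T\<close> number at most the product of its
  three codegrees, so if each fat triangle had a side of codegree below \<open>(1 - \<delta>/2) n\<close>, there
  would be at most about \<open>(1 - \<delta>/2) n\<^sup>3\<close> copies of \<open>C\<^sub>6\<close>. A fat triangle without such a side is the
  required triple.
\<close>

section \<open>Tools: dense subrelations and almost disjoint sets\<close>

text \<open>Delete elements of degree at most \<open>m\<close> one at a time. Each deletion costs at
  most \<open>m\<close> pairs and lowers the budget \<open>m * (card A + card B)\<close> by
  \<open>m\<close>, so the strict excess persists and the process stops at a nonempty
  relation.\<close>

lemma rich_subrelation:
  fixes E :: "('b \<times> 'c) set"
  assumes "finite A" "finite B" "E \<subseteq> A \<times> B" "card E > m * (card A + card B)"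
  shows "\<exists>E'\<subseteq>E. E' \<noteq> {} \<and>
    (\<forall>(a, b)\<in>E'. card {b'. (a, b') \<in> E'} > m \<and> card {a'. (a', b) \<in> E'} > m)"
  using assms
proof (induction "card A + card B" arbitrary: A B E rule: less_induct)
  case less
  have finE: "finite E"
    using less.prems finite_subset by blast
  show ?case
  proof (cases "(\<forall>a\<in>A. card {b'. (a, b') \<in> E} > m) \<and> (\<forall>b\<in>B. card {a'. (a', b) \<in> E} > m)")
    case True
    moreover have "E \<noteq> {}"
      using less.prems(4) by auto
    ultimately show ?thesis
      using less.prems(3) by (intro exI[of _ E]) auto
  next
    case False
    then consider (row) a where "a \<in> A" "card {b'. (a, b') \<in> E} \<le> m"
      | (col) b where "b \<in> B" "card {a'. (a', b) \<in> E} \<le> m"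
      by (meson not_le)
    then show ?thesis
    proof cases
      case row
      define E1 where "E1 = {e \<in> E. fst e \<noteq> a}"
      have E: "E = E1 \<union> Pair a ` {b'. (a, b') \<in> E}"
        by (auto simp: E1_def)
      have "finite {b'. (a, b') \<in> E}"
        using finE by (rule finite_surj[of _ _ snd]) (auto intro: rev_image_eqI)
      then have "card (E1 \<union> Pair a ` {b'. (a, b') \<in> E}) \<le> card E1 + card {b'. (a, b') \<in> E}"
        by (intro order_trans[OF card_Un_le] add_left_mono card_image_le)
      then have le: "card E \<le> card E1 + card {b'. (a, b') \<in> E}"
        unfolding E[symmetric] .
      have A: "card A = Suc (card (A - {a}))"
        using less.prems(1) row(1) by (rule card.remove)
      have big: "card E1 > m * (card (A - {a}) + card B)"
        using le row(2) less.prems(4) unfolding A add_Suc mult_Suc_right by linarith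
      have E1: "E1 \<subseteq> (A - {a}) \<times> B"
        using less.prems(3) by (auto simp: E1_def)
      obtain E' where "E' \<subseteq> E1" "E' \<noteq> {}"
        "\<forall>(a, b)\<in>E'. card {b'. (a, b') \<in> E'} > m \<and> card {a'. (a', b) \<in> E'} > m"
        using less.hyps[OF _ _ _ E1 big] A less.prems(1,2) by auto
      moreover have "E1 \<subseteq> E"
        by (auto simp: E1_def)
      ultimately show ?thesis
        by blast
    next
      case col
      define E1 where "E1 = {e \<in> E. snd e \<noteq> b}"
      have E: "E = E1 \<union> (\<lambda>a. (a, b)) ` {a'. (a', b) \<in> E}"
        by (auto simp: E1_def)
      have "finite {a'. (a', b) \<in> E}"
        using finE by (rule finite_surj[of _ _ fst]) (auto intro: rev_image_eqI)
      then have "card (E1 \<union> (\<lambda>a. (a, b)) ` {a'. (a', b) \<in> E})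
          \<le> card E1 + card {a'. (a', b) \<in> E}"
        by (intro order_trans[OF card_Un_le] add_left_mono card_image_le)
      then have le: "card E \<le> card E1 + card {a'. (a', b) \<in> E}"
        unfolding E[symmetric] .
      have B: "card B = Suc (card (B - {b}))"
        using less.prems(2) col(1) by (rule card.remove)
      have big: "card E1 > m * (card A + card (B - {b}))"
        using le col(2) less.prems(4) unfolding B add_Suc_right mult_Suc_right by linarith
      have E1: "E1 \<subseteq> A \<times> (B - {b})"
        using less.prems(3) by (auto simp: E1_def)
      obtain E' where "E' \<subseteq> E1" "E' \<noteq> {}"
        "\<forall>(a, b)\<in>E'. card {b'. (a, b') \<in> E'} > m \<and> card {a'. (a', b) \<in> E'} > m"
        using less.hyps[OF _ _ _ E1 big] B less.prems(1,2) by auto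
      moreover have "E1 \<subseteq> E"
        by (auto simp: E1_def)
      ultimately show ?thesis
        by blast
    qed
  qed
qed

lemma exists_outside_list:
  assumes "card A > length xs"
  shows "\<exists>x\<in>A. x \<notin> set xs"
proof (rule ccontr)
  assume "\<not> ?thesis"
  then have "A \<subseteq> set xs"
    by blast
  then have "card A \<le> card (set xs)"
    by (simp add: card_mono)
  then show False
    using assms card_length[of xs] by linarith
qed

text \<open>The case \<open>m = 8\<close>, phrased for growing a path greedily: each new vertex can
  be chosen off a list of at most eight vertices already visited.\<close>

lemma rich_subrelation_avoiding:
  fixes E :: "('a \<times> 'a) set"
  assumes "finite A" "finite B" "E \<subseteq> A \<times> B" "card E > 8 * (card A + card B)"
  obtains E' where "E' \<subseteq> E" "E' \<noteq> {}"
    "\<And>a b xs. (a, b) \<in> E' \<Longrightarrow> length xs \<le> 8 \<Longrightarrow> \<exists>b'. (a, b') \<in> E' \<and> b' \<notin> set xs"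
    "\<And>a b xs. (a, b) \<in> E' \<Longrightarrow> length xs \<le> 8 \<Longrightarrow> \<exists>a'. (a', b) \<in> E' \<and> a' \<notin> set xs"
proof -
  obtain E' where E': "E' \<subseteq> E" "E' \<noteq> {}"
    "\<forall>(a, b)\<in>E'. card {b'. (a, b') \<in> E'} > 8 \<and> card {a'. (a', b) \<in> E'} > 8"
    using rich_subrelation[OF assms] by blast
  show thesis
  proof (rule that[OF E'(1,2)])
    fix a b :: 'a and xs :: "'a list"
    assume *: "(a, b) \<in> E'" "length xs \<le> 8"
    have "card {b'. (a, b') \<in> E'} > length xs" "card {a'. (a', b) \<in> E'} > length xs"
      using bspec[OF E'(3) *(1)] *(2) by auto
    then show "\<exists>b'. (a, b') \<in> E' \<and> b' \<notin> set xs" "\<exists>a'. (a', b) \<in> E' \<and> a' \<notin> set xs"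
      using exists_outside_list[of xs "{b'. (a, b') \<in> E'}"]
        exists_outside_list[of xs "{a'. (a', b) \<in> E'}"] by blast+
  qed
qed

text \<open>Two of the sets share at most one point, hence no ordered pair of distinct points. The
  off-diagonal parts of the squares \<open>S i \<times> S i\<close> are therefore disjoint subsets
  of \<open>V \<times> V\<close>; the diagonals contribute the linear sum.\<close>

lemma sum_card_squares_le:
  fixes S :: "'i \<Rightarrow> 'a set"
  assumes "finite I" "finite V" "\<And>i. i \<in> I \<Longrightarrow> S i \<subseteq> V"
    and inter: "\<And>i j x y. \<lbrakk>i \<in> I; j \<in> I; i \<noteq> j; x \<in> S i \<inter> S j; y \<in> S i \<inter> S j\<rbrakk> \<Longrightarrow> x = y"
  shows "(\<Sum>i\<in>I. card (S i) * card (S i)) \<le> card V * card V + (\<Sum>i\<in>I. card (S i))"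
proof -
  have fin: "finite (S i)" if "i \<in> I" for i
    using assms that finite_subset by blast
  define D where "D i = S i \<times> S i - (\<lambda>x. (x, x)) ` S i" for i
  have D: "card (S i) * card (S i) = card (D i) + card (S i)" if "i \<in> I" for i
  proof -
    have "card ((\<lambda>x. (x, x)) ` S i) = card (S i)"
      by (intro card_image inj_onI) simp
    moreover have "card (D i) = card (S i \<times> S i) - card ((\<lambda>x. (x, x)) ` S i)"
      unfolding D_def using fin[OF that] by (intro card_Diff_subset) auto
    moreover have "card ((\<lambda>x. (x, x)) ` S i) \<le> card (S i \<times> S i)"
      using fin[OF that] by (intro card_mono) auto
    ultimately show ?thesis
      by (simp add: card_cartesian_product)
  qed
  have "(\<Sum>i\<in>I. card (D i)) = card (\<Union>i\<in>I. D i)"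
  proof (rule card_UN_disjoint[symmetric])
    show "\<forall>i\<in>I. \<forall>j\<in>I. i \<noteq> j \<longrightarrow> D i \<inter> D j = {}"
      using inter unfolding D_def by fast
  qed (use assms fin in \<open>auto simp: D_def\<close>)
  also have "\<dots> \<le> card (V \<times> V)"
    using assms by (intro card_mono) (auto simp: D_def)
  finally show ?thesis
    by (simp add: D sum.distrib card_cartesian_product)
qed

section \<open>Sparsity around a vertex of a graph without 8-cycles\<close>

locale C8_free_graph =
  fixes G :: "'a graph"
  assumes simple: "simple_graph G"
    and C8_free: "free_of (cycle_graph 8) G"
begin

abbreviation V where "V \<equiv> verts G"
abbreviation N where "N \<equiv> neighborhood G"
abbreviation n where "n \<equiv> card V"

definition adj where "adj u v \<longleftrightarrow> {u, v} \<in> edges G"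

lemma finite_V [simp]: "finite V"
  using simple by (simp add: simple_graph_def)

lemma adj_sym: "adj u v \<longleftrightarrow> adj v u"
  by (simp add: adj_def insert_commute)

lemma adj_verts: "adj u v \<Longrightarrow> u \<in> V \<and> v \<in> V"
  using simple unfolding adj_def simple_graph_def by blast

lemma adj_irrefl [simp]: "\<not> adj u u"
proof
  assume "adj u u"
  then have "card {u, u} = 2"
    using simple unfolding adj_def simple_graph_def by blast
  then show False
    by simp
qed

lemma in_N [simp]: "u \<in> N v \<longleftrightarrow> adj v u"
  using adj_verts[of v u] by (auto simp: neighborhood_def adj_def)

lemma N_subset: "N v \<subseteq> V"
  by (auto simp: neighborhood_def)

lemma finite_N [simp]: "finite (N v)"
  using N_subset finite_V finite_subset by blast

lemma card_N_le: "card (N v) \<le> n"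
  by (simp add: N_subset card_mono)

text \<open>Unfolds freeness once and for all into eight vertices and adjacencies; every later
  contradiction exhibits an explicit 8-cycle through it.\<close>

lemma no_C8:
  assumes "distinct [a, b, c, d, e, f, g, h]"
    and "adj a b" "adj b c" "adj c d" "adj d e" "adj e f" "adj f g" "adj g h" "adj h a"
  shows False
proof -
  define H where "H = ({a, b, c, d, e, f, g, h},
    {{a, b}, {b, c}, {c, d}, {d, e}, {e, f}, {f, g}, {g, h}, {h, a}})"
  define \<phi> where "\<phi> i = [a, b, c, d, e, f, g, h] ! i" for i
  have "simple_graph H"
    using assms(1) by (auto simp: simple_graph_def H_def)
  moreover have "verts H \<subseteq> V"
    using assms(2-)[THEN adj_verts] by (simp add: H_def)
  moreover have "edges H \<subseteq> edges G"
    using assms(2-) by (simp add: H_def adj_def)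
  ultimately have "subgraph H G"
    by (simp add: subgraph_def)
  moreover have "graph_iso (cycle_graph 8) H"
    unfolding graph_iso_def
  proof (intro exI[of _ \<phi>] conjI)
    have 8: "{..<8} = {0, 1, 2, 3, 4, 5, 6, 7::nat}"
      by auto
    have "edges (cycle_graph 8) = (\<lambda>i. {i, Suc i mod 8}) ` {..<8}"
      by (auto simp: cycle_graph_def)
    then show "edges H = (`) \<phi> ` edges (cycle_graph 8)"
      by (simp add: 8 \<phi>_def H_def)
    have "inj_on \<phi> {..<8}"
      using assms(1) inj_on_nth[of "[a, b, c, d, e, f, g, h]" "{..<8}"]
      by (simp add: \<phi>_def[abs_def])
    then show "bij_betw \<phi> (verts (cycle_graph 8)) (verts H)"
      by (simp add: bij_betw_def cycle_graph_def 8 \<phi>_def H_def)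
  qed
  ultimately have "\<exists>H. subgraph H G \<and> graph_iso (cycle_graph 8) H"
    by (intro exI[of _ H] conjI)
  with C8_free show False
    unfolding free_of_def by (rule notE)
qed

text \<open>With more edges, a rich subrelation contains a path \<open>x1 y1 x2 y2 x3 y3 x4\<close>
  that starts and ends in \<open>N v\<close>; the vertex \<open>v\<close> closes it to an 8-cycle.
  As \<open>B\<close> may overlap \<open>N v\<close>, each new vertex has to avoid the whole path so
  far, not only its own side.\<close>

lemma card_edges_nbhd_le:
  assumes "B \<subseteq> V - {v}"
  shows "card {(x, y). x \<in> N v \<and> y \<in> B \<and> adj x y} \<le> 8 * (card (N v) + card B)"
proof (rule ccontr)
  let ?E = "{(x, y). x \<in> N v \<and> y \<in> B \<and> adj x y}"
  assume "\<not> ?thesis"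
  then have "card ?E > 8 * (card (N v) + card B)"
    by simp
  moreover have "finite B"
    using assms finite_V finite_subset by blast
  moreover have "?E \<subseteq> N v \<times> B"
    by auto
  ultimately obtain E where E: "E \<subseteq> ?E" "E \<noteq> {}"
    "\<And>a b xs. (a, b) \<in> E \<Longrightarrow> length xs \<le> 8 \<Longrightarrow> \<exists>b'. (a, b') \<in> E \<and> b' \<notin> set xs"
    "\<And>a b xs. (a, b) \<in> E \<Longrightarrow> length xs \<le> 8 \<Longrightarrow> \<exists>a'. (a', b) \<in> E \<and> a' \<notin> set xs"
    using rich_subrelation_avoiding[of "N v" B ?E] by auto
  have E_adj: "adj v x \<and> adj x y \<and> y \<noteq> v" if "(x, y) \<in> E" for x y
    using that E(1) assms by auto
  obtain x1 y1 where 1: "(x1, y1) \<in> E"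
    using E(2) by auto
  obtain x2 where 2: "(x2, y1) \<in> E" "x2 \<notin> set [x1, y1]"
    using E(4)[OF 1, of "[x1, y1]"] by auto
  obtain y2 where 3: "(x2, y2) \<in> E" "y2 \<notin> set [x1, y1, x2]"
    using E(3)[OF 2(1), of "[x1, y1, x2]"] by auto
  obtain x3 where 4: "(x3, y2) \<in> E" "x3 \<notin> set [x1, y1, x2, y2]"
    using E(4)[OF 3(1), of "[x1, y1, x2, y2]"] by auto
  obtain y3 where 5: "(x3, y3) \<in> E" "y3 \<notin> set [x1, y1, x2, y2, x3]"
    using E(3)[OF 4(1), of "[x1, y1, x2, y2, x3]"] by auto
  obtain x4 where 6: "(x4, y3) \<in> E" "x4 \<notin> set [x1, y1, x2, y2, x3, y3]"
    using E(4)[OF 5(1), of "[x1, y1, x2, y2, x3, y3]"] by auto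
  note E' = E_adj[OF 1] E_adj[OF 2(1)] E_adj[OF 3(1)] E_adj[OF 4(1)] E_adj[OF 5(1)] E_adj[OF 6(1)]
  have "distinct [v, x1, y1, x2, y2, x3, y3, x4]"
    using E' 2(2) 3(2) 4(2) 5(2) 6(2) by auto
  moreover have "adj y1 x2" "adj y2 x3" "adj y3 x4" "adj x4 v"
    using E' by (simp_all add: adj_sym)
  ultimately show False
    using no_C8[of v x1 y1 x2 y2 x3 y3 x4] E' by blast
qed

lemma card_edges_second_nbhd_le:
  "card {(y, w). y \<noteq> v \<and> w \<noteq> v \<and> \<not> adj v y \<and> \<not> adj v w \<and> adj y w \<and> N v \<inter> N y \<noteq> {}}
    \<le> 16 * n"
proof (rule ccontr)
  let ?E = "{(y, w). y \<noteq> v \<and> w \<noteq> v \<and> \<not> adj v y \<and> \<not> adj v w \<and> adj y w \<and> N v \<inter> N y \<noteq> {}}"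
  assume "\<not> ?thesis"
  then have big: "card ?E > 8 * (n + n)"
    by simp
  have sub: "?E \<subseteq> V \<times> V"
    by (auto dest: adj_verts)
  obtain E where E: "E \<subseteq> ?E" "E \<noteq> {}"
    "\<And>a b xs. (a, b) \<in> E \<Longrightarrow> length xs \<le> 8 \<Longrightarrow> \<exists>b'. (a, b') \<in> E \<and> b' \<notin> set xs"
    "\<And>a b xs. (a, b) \<in> E \<Longrightarrow> length xs \<le> 8 \<Longrightarrow> \<exists>a'. (a', b) \<in> E \<and> a' \<notin> set xs"
    using rich_subrelation_avoiding[OF finite_V finite_V sub big] by blast
  \<comment> \<open>A chosen parent of \<open>y\<close>: the middle of one path of length two from
    \<open>v\<close> to \<open>y\<close>.\<close>
  define p where "p y = (SOME x. x \<in> N v \<inter> N y)" for y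
  have p: "adj v (p y) \<and> adj (p y) y" if "(y, w) \<in> E" for y w
  proof -
    have "N v \<inter> N y \<noteq> {}"
      using that E(1) by auto
    then have "p y \<in> N v \<inter> N y"
      unfolding p_def some_in_eq .
    then show ?thesis
      by (simp add: adj_sym)
  qed
  have E_adj: "y \<noteq> v \<and> w \<noteq> v \<and> \<not> adj v y \<and> \<not> adj v w \<and> adj y w" if "(y, w) \<in> E" for y w
    using that E(1) by auto
  \<comment> \<open>A path of length 4 whose ends have different parents closes up through \<open>v\<close>. So all parents along
    a path agree, and a path of length 6 closes up through the common parent.\<close>
  have ends: "p y1 = p y3"
    if E': "(y1, w1) \<in> E" "(y2, w1) \<in> E" "(y2, w2) \<in> E" "(y3, w2) \<in> E"
      and dist: "distinct [y1, w1, y2, w2, y3]" for y1 w1 y2 w2 y3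
  proof (rule ccontr)
    assume ne: "p y1 \<noteq> p y3"
    have "distinct [v, p y1, y1, w1, y2, w2, y3, p y3]"
      using dist ne E'[THEN E_adj] p[OF E'(1)] p[OF E'(4)] by auto
    moreover have "adj w1 y2" "adj w2 y3" "adj y3 (p y3)" "adj (p y3) v"
      using E'[THEN E_adj] p[OF E'(4)] by (simp_all add: adj_sym)
    ultimately show False
      using no_C8[of v "p y1" y1 w1 y2 w2 y3 "p y3"] p[OF E'(1)] E'[THEN E_adj] by blast
  qed
  \<comment> \<open>Both \<open>y1\<close> and \<open>z\<close> begin a path
    \<open>_ w y2 w2 y3\<close> with the same far end \<open>y3\<close>, so both parents equal
    \<open>p y3\<close>.\<close>
  have siblings: "p y1 = p z"
    if yz: "(y1, w) \<in> E" "(y2, w) \<in> E" "(z, w) \<in> E" "distinct [y1, y2, z]"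
    for y1 y2 z w
  proof -
    obtain w2 where 1: "(y2, w2) \<in> E" "w2 \<notin> set [y1, y2, z, w]"
      using E(3)[OF yz(2), of "[y1, y2, z, w]"] by auto
    obtain y3 where 2: "(y3, w2) \<in> E" "y3 \<notin> set [y1, y2, z, w, w2]"
      using E(4)[OF 1(1), of "[y1, y2, z, w, w2]"] by auto
    have "w \<notin> set [y1, y2, z]"
      using E_adj[OF yz(1)] E_adj[OF yz(2)] E_adj[OF yz(3)] by auto
    then have "p y1 = p y3" "p z = p y3"
      using ends[of y1 w y2 w2 y3] ends[of z w y2 w2 y3] 1 2 yz by auto
    then show ?thesis
      by simp
  qed
  \<comment> \<open>A third first coordinate \<open>z\<close> over the same \<open>w\<close> takes
    the place of the middle vertex in \<open>siblings\<close>.\<close>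
  have siblings2: "p y1 = p y2" if yy: "(y1, w) \<in> E" "(y2, w) \<in> E" "y1 \<noteq> y2" for y1 y2 w
  proof -
    obtain z where z: "(z, w) \<in> E" "z \<notin> set [y1, y2]"
      using E(4)[OF yy(1), of "[y1, y2]"] by auto
    then show ?thesis
      using siblings[of y1 w z y2] yy by auto
  qed
  obtain x1 y1 where 1: "(x1, y1) \<in> E"
    using E(2) by auto
  obtain x2 where 2: "(x2, y1) \<in> E" "x2 \<notin> set [x1, y1]"
    using E(4)[OF 1, of "[x1, y1]"] by auto
  obtain y2 where 3: "(x2, y2) \<in> E" "y2 \<notin> set [x1, y1, x2]"
    using E(3)[OF 2(1), of "[x1, y1, x2]"] by auto
  obtain x3 where 4: "(x3, y2) \<in> E" "x3 \<notin> set [x1, y1, x2, y2]"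
    using E(4)[OF 3(1), of "[x1, y1, x2, y2]"] by auto
  obtain y3 where 5: "(x3, y3) \<in> E" "y3 \<notin> set [x1, y1, x2, y2, x3]"
    using E(3)[OF 4(1), of "[x1, y1, x2, y2, x3]"] by auto
  obtain x4 where 6: "(x4, y3) \<in> E" "x4 \<notin> set [x1, y1, x2, y2, x3, y3]"
    using E(4)[OF 5(1), of "[x1, y1, x2, y2, x3, y3]"] by auto
  have "p x1 = p x2" "p x2 = p x3" "p x3 = p x4"
    using siblings2[OF 1 2(1)] siblings2[OF 3(1) 4(1)] siblings2[OF 5(1) 6(1)] 2(2) 4(2) 6(2)
    by auto
  then have p14: "adj v (p x1)" "adj (p x1) x1" "adj x4 (p x1)"
    using p[OF 1] p[OF 6(1)] by (simp_all add: adj_sym)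
  have adjs: "adj x1 y1" "adj y1 x2" "adj x2 y2" "adj y2 x3" "adj x3 y3" "adj y3 x4"
    using E_adj[OF 1] E_adj[OF 2(1)] E_adj[OF 3(1)] E_adj[OF 4(1)] E_adj[OF 5(1)] E_adj[OF 6(1)]
    by (simp_all add: adj_sym)
  \<comment> \<open>The parent is adjacent to \<open>v\<close>, whereas no vertex of the path
    is.\<close>
  have "p x1 \<notin> set [x1, y1, x2, y2, x3, y3, x4]"
    using p14(1) E_adj[OF 1] E_adj[OF 3(1)] E_adj[OF 5(1)] E_adj[OF 6(1)] by auto
  then have "distinct [p x1, x1, y1, x2, y2, x3, y3, x4]"
    using 2 3 4 5 6 adjs(1) by auto
  then show False
    using no_C8[of "p x1" x1 y1 x2 y2 x3 y3 x4] p14 adjs by blast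
qed

section \<open>Degree sums and walks from a vertex\<close>

text \<open>The sum counts walks of length two from \<open>v\<close>. Those not returning to
  \<open>v\<close> number at most \<open>16 * n\<close> by \<open>card_edges_nbhd_le\<close>; those
  returning account for the seventeenth \<open>n\<close>.\<close>

lemma sum_degree_N_le: "(\<Sum>u\<in>N v. card (N u)) \<le> 17 * n"
proof (cases "v \<in> V")
  case True
  let ?E = "{(x, y). x \<in> N v \<and> y \<in> V - {v} \<and> adj x y}"
  have "(\<Sum>u\<in>N v. card (N u)) = card (SIGMA u:N v. N u)"
    by simp
  also have "(SIGMA u:N v. N u) \<subseteq> ?E \<union> (\<lambda>u. (u, v)) ` N v"
    by (auto dest: adj_verts)
  then have "card (SIGMA u:N v. N u) \<le> card (?E \<union> (\<lambda>u. (u, v)) ` N v)"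
    by (rule card_mono[rotated]) (auto intro: finite_subset[of _ "V \<times> V"] dest: adj_verts)
  also have "\<dots> \<le> card ?E + card (N v)"
    using card_Un_le[of ?E "(\<lambda>u. (u, v)) ` N v"] card_image_le[OF finite_N, of "\<lambda>u. (u, v)" v]
    by linarith
  also have "\<dots> \<le> 8 * (card (N v) + card (V - {v})) + card (N v)"
    using card_edges_nbhd_le[of "V - {v}" v] by simp
  also have "\<dots> \<le> 17 * n"
    using add_mono[OF mult_le_mono2[OF add_mono[OF card_N_le[of v] card_Diff1_le[of V v]], of 8] card_N_le[of v]]
    by simp
  finally show ?thesis .
next
  case False
  then have "N v = {}"
    by (auto dest: adj_verts)
  then show ?thesis
    by simp
qed

text \<open>Double counting: each \<open>v\<close> passes its degree to each of its neighbours, so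
  the sum of squares is the sum over \<open>x\<close> of the degrees of the neighbours of
  \<open>x\<close>.\<close>

lemma sum_degree_squares_le: "(\<Sum>v\<in>V. card (N v) * card (N v)) \<le> 17 * n * n"
proof -
  have N1: "N v = {x \<in> V. adj v x}" for v
    by (auto dest: adj_verts)
  have N2: "N x = {v \<in> V. adj v x}" for x
    unfolding N1 by (simp only: adj_sym[of x])
  have "(\<Sum>v\<in>V. card (N v) * card (N v)) = (\<Sum>v\<in>V. \<Sum>x\<in>N v. card (N v))"
    by simp
  also have "\<dots> = (\<Sum>v\<in>V. \<Sum>x\<in>{x\<in>V. adj v x}. card (N v))"
    by (rule sum.cong[OF refl], rule sum.cong[OF N1 refl])
  also have "\<dots> = (\<Sum>x\<in>V. \<Sum>v\<in>{v\<in>V. adj v x}. card (N v))"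
    by (rule sum.swap_restrict) simp_all
  also have "\<dots> = (\<Sum>x\<in>V. \<Sum>v\<in>N x. card (N v))"
    by (rule sum.cong[OF refl], rule sum.cong[OF N2[symmetric] refl])
  also have "\<dots> \<le> (\<Sum>x\<in>V. 17 * n)"
    by (intro sum_mono sum_degree_N_le)
  finally show ?thesis
    by (simp add: algebra_simps)
qed

text \<open>Cauchy-Schwarz applied to the sum of squared degrees.\<close>

lemma sum_degree_le: "real (\<Sum>v\<in>V. card (N v)) \<le> 5 * real n * sqrt (real n)"
proof -
  have "(\<Sum>v\<in>V. real (card (N v)))\<^sup>2 \<le> (\<Sum>v\<in>V. (real (card (N v)))\<^sup>2) * real n"
    by (rule sum_squared_le_sum_of_squares)
  also have "(\<Sum>v\<in>V. (real (card (N v)))\<^sup>2) = real (\<Sum>v\<in>V. card (N v) * card (N v))"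
    by (simp add: power2_eq_square)
  also have "\<dots> * real n \<le> real (17 * n * n) * real n"
    by (rule mult_right_mono[OF of_nat_mono[OF sum_degree_squares_le]]) simp
  \<comment> \<open>17 is rounded up to a perfect square to obtain the factor 5.\<close>
  also have "\<dots> \<le> 25 * ((real n)\<^sup>2 * real n)"
    by (simp add: power2_eq_square)
  also have "\<dots> = (5 * real n * sqrt (real n))\<^sup>2"
    by (simp add: power_mult_distrib)
  finally have "(\<Sum>v\<in>V. real (card (N v))) \<le> 5 * real n * sqrt (real n)"
    by (rule power2_le_imp_le) simp
  then show ?thesis
    by simp
qed

text \<open>The last edge \<open>(y, w)\<close> of a walk of length three from \<open>v\<close>. The
  vertex between \<open>v\<close> and \<open>y\<close> is forgotten here: for thin pairs it can be
  restored in at most \<open>K\<close> ways.\<close>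

definition two_paths where
  "two_paths v = {(y, w). y \<noteq> v \<and> w \<noteq> v \<and> adj y w \<and> N v \<inter> N y \<noteq> {}}"

lemma finite_two_paths [simp]: "finite (two_paths v)"
  by (rule finite_subset[of _ "V \<times> V"]) (auto simp: two_paths_def dest: adj_verts)

text \<open>The edge \<open>y w\<close> either has an end in \<open>N v\<close>, which is counted by
  \<open>card_edges_nbhd_le\<close> in each orientation, or avoids \<open>N v\<close> and falls
  under \<open>card_edges_second_nbhd_le\<close>. Each of the three parts has size at most
  \<open>16 * n\<close>.\<close>

lemma card_two_paths_le: "card (two_paths v) \<le> 48 * n"
proof -
  let ?E = "{(x, y). x \<in> N v \<and> y \<in> V - {v} \<and> adj x y}"
  let ?F = "{(y, w). y \<noteq> v \<and> w \<noteq> v \<and> \<not> adj v y \<and> \<not> adj v w \<and> adj y w \<and> N v \<inter> N y \<noteq> {}}"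
  have fin: "finite ?E" "finite ?F"
    by (rule finite_subset[of _ "V \<times> V"]; auto dest: adj_verts)+
  have "card ?E \<le> 8 * (card (N v) + card (V - {v}))"
    by (rule card_edges_nbhd_le) simp
  also have "\<dots> \<le> 16 * n"
    using mult_le_mono2[OF add_mono[OF card_N_le[of v] card_Diff1_le[of V v]], of 8] by simp
  finally have E: "card ?E \<le> 16 * n" .
  have "two_paths v \<subseteq> ?E \<union> prod.swap ` ?E \<union> ?F"
  proof
    fix e assume "e \<in> two_paths v"
    then obtain y w where e: "e = (y, w)" "y \<noteq> v" "w \<noteq> v" "adj y w" "N v \<inter> N y \<noteq> {}"
      by (auto simp: two_paths_def)
    consider "adj v y" | "adj v w" | "\<not> adj v y" "\<not> adj v w"
      by blast
    then show "e \<in> ?E \<union> prod.swap ` ?E \<union> ?F"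
    proof cases
      case 1
      then have "e \<in> ?E"
        using e by (auto dest: adj_verts)
      then show ?thesis
        by (rule UnI1[OF UnI1])
    next
      case 2
      then have "(w, y) \<in> ?E"
        using e by (auto dest: adj_verts simp: adj_sym)
      then have "e \<in> prod.swap ` ?E"
        by (rule rev_image_eqI) (simp add: e(1))
      then show ?thesis
        by (rule UnI1[OF UnI2])
    next
      case 3
      then have "e \<in> ?F"
        using e by auto
      then show ?thesis
        by (rule UnI2)
    qed
  qed
  then have "card (two_paths v) \<le> card (?E \<union> prod.swap ` ?E \<union> ?F)"
    using fin by (intro card_mono) auto
  also have "\<dots> \<le> card ?E + card (prod.swap ` ?E) + card ?F"
    using card_Un_le[of "?E \<union> prod.swap ` ?E" ?F] card_Un_le[of ?E "prod.swap ` ?E"] by linarith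
  also have "\<dots> \<le> 16 * n + 16 * n + 16 * n"
    using E card_image_le[OF fin(1), of prod.swap] card_edges_second_nbhd_le[of v] by linarith
  finally show ?thesis
    by simp
qed

section \<open>6-cycles as tuples of vertices\<close>

definition hexagon where
  "hexagon v0 v1 v2 v3 v4 v5 \<longleftrightarrow> distinct [v0, v1, v2, v3, v4, v5] \<and>
    adj v0 v1 \<and> adj v1 v2 \<and> adj v2 v3 \<and> adj v3 v4 \<and> adj v4 v5 \<and> adj v5 v0"

text \<open>Forgets starting point and direction, so that taking images under it counts copies
  instead of tuples.\<close>

definition hexagon_graph :: "'a \<times> 'a \<times> 'a \<times> 'a \<times> 'a \<times> 'a \<Rightarrow> 'a graph" where
  "hexagon_graph = (\<lambda>(v0, v1, v2, v3, v4, v5). ({v0, v1, v2, v3, v4, v5},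
    {{v0, v1}, {v1, v2}, {v2, v3}, {v3, v4}, {v4, v5}, {v5, v0}}))"

lemma hexagon_rotate: "hexagon v0 v1 v2 v3 v4 v5 \<Longrightarrow> hexagon v1 v2 v3 v4 v5 v0"
  by (auto simp: hexagon_def)

lemma hexagon_graph_rotate:
  "hexagon_graph (v1, v2, v3, v4, v5, v0) = hexagon_graph (v0, v1, v2, v3, v4, v5)"
  by (auto simp: hexagon_graph_def)

lemma hexagon_graph_reverse:
  "hexagon_graph (v0, v5, v4, v3, v2, v1) = hexagon_graph (v0, v1, v2, v3, v4, v5)"
  by (simp add: hexagon_graph_def insert_commute)

lemma hexagon_graph_rotate2:
  "hexagon_graph (v2, v3, v4, v5, v0, v1) = hexagon_graph (v0, v1, v2, v3, v4, v5)"
  by (rule trans[OF hexagon_graph_rotate hexagon_graph_rotate])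

lemma hexagon_verts:
  "hexagon v0 v1 v2 v3 v4 v5 \<Longrightarrow> v0 \<in> V \<and> v1 \<in> V \<and> v2 \<in> V \<and> v3 \<in> V \<and> v4 \<in> V \<and> v5 \<in> V"
  using adj_verts[of v0 v1] adj_verts[of v2 v3] adj_verts[of v4 v5] by (simp add: hexagon_def)

lemma copies_C6:
  assumes "H \<in> copies (cycle_graph 6) G"
  obtains v0 v1 v2 v3 v4 v5 where "hexagon v0 v1 v2 v3 v4 v5"
    "H = hexagon_graph (v0, v1, v2, v3, v4, v5)"
proof -
  obtain f where f: "bij_betw f (verts (cycle_graph 6)) (verts H)"
    "edges H = (`) f ` edges (cycle_graph 6)" and sub: "subgraph H G"
    using assms unfolding copies_def graph_iso_def by blast
  have 6: "{..<6} = {0, 1, 2, 3, 4, 5::nat}"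
    by auto
  have "edges (cycle_graph 6) = (\<lambda>i. {i, Suc i mod 6}) ` {..<6}"
    by (auto simp: cycle_graph_def)
  then have edges: "edges H = {{f 0, f 1}, {f 1, f 2}, {f 2, f 3}, {f 3, f 4}, {f 4, f 5}, {f 5, f 0}}"
    using f(2) by (simp add: 6 numeral_2_eq_2[symmetric])
  have verts: "verts H = {f 0, f 1, f 2, f 3, f 4, f 5}"
    using f(1) unfolding bij_betw_def by (simp add: cycle_graph_def 6)
  have "inj_on f {0, 1, 2, 3, 4, 5}"
    using f(1) unfolding bij_betw_def by (simp add: cycle_graph_def 6)
  then have "distinct [f 0, f 1, f 2, f 3, f 4, f 5]"
    by (auto simp: inj_on_def)
  moreover have "edges H \<subseteq> edges G"
    using sub by (simp add: subgraph_def)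
  ultimately have "hexagon (f 0) (f 1) (f 2) (f 3) (f 4) (f 5)"
    unfolding edges hexagon_def adj_def by simp
  moreover have "H = hexagon_graph (f 0, f 1, f 2, f 3, f 4, f 5)"
    using verts edges by (simp add: hexagon_graph_def prod_eq_iff)
  ultimately show thesis
    by (rule that)
qed

end

section \<open>Fat pairs\<close>

locale C8_free_graph_threshold = C8_free_graph +
  fixes K :: nat
  assumes K_ge: "8 \<le> K"
begin

definition codeg where "codeg a b = card (N a \<inter> N b)"

definition fat where "fat a b \<longleftrightarrow> a \<noteq> b \<and> K \<le> codeg a b"

definition F where "F a = {b \<in> V. fat a b}"

lemma codeg_sym: "codeg a b = codeg b a"
  by (simp add: codeg_def Int_commute)

lemma fat_sym: "fat a b \<longleftrightarrow> fat b a"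
  by (auto simp: fat_def codeg_sym)

lemma fat_neq: "fat a b \<Longrightarrow> a \<noteq> b"
  by (simp add: fat_def)

text \<open>Since \<open>K\<close> is at least 8, seven vertices can be avoided. A fat pair thus
  acts as a path of length two with a fresh middle, even when the other seven vertices of an 8-cycle
  are fixed.\<close>

lemma fat_middle:
  assumes "fat a b" "length xs \<le> 7"
  obtains x where "adj a x" "adj x b" "x \<notin> set xs"
proof -
  have "card (N a \<inter> N b) > length xs"
    using assms K_ge by (simp add: fat_def codeg_def)
  then obtain x where "x \<in> N a \<inter> N b" "x \<notin> set xs"
    using exists_outside_list by blast
  then show thesis
    using that[of x] adj_sym[of b x] by simp
qed

lemma fat_verts: "fat a b \<Longrightarrow> a \<in> V \<and> b \<in> V"
  by (rule fat_middle[of a b "[]"]) (auto dest: adj_verts)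

text \<open>Subdividing each of the four fat pairs by a fresh common neighbour gives an
  8-cycle.\<close>

lemma no_fat_C4:
  assumes "fat a b" "fat b c" "fat c d" "fat d a" "distinct [a, b, c, d]"
  shows False
proof -
  obtain p where p: "adj a p" "adj p b" "p \<notin> set [a, b, c, d]"
    using fat_middle[OF assms(1), of "[a, b, c, d]"] by auto
  obtain q where q: "adj b q" "adj q c" "q \<notin> set [a, b, c, d, p]"
    using fat_middle[OF assms(2), of "[a, b, c, d, p]"] by auto
  obtain r where r: "adj c r" "adj r d" "r \<notin> set [a, b, c, d, p, q]"
    using fat_middle[OF assms(3), of "[a, b, c, d, p, q]"] by auto
  obtain s where s: "adj d s" "adj s a" "s \<notin> set [a, b, c, d, p, q, r]"
    using fat_middle[OF assms(4), of "[a, b, c, d, p, q, r]"] by auto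
  have "distinct [a, p, b, q, c, r, d, s]"
    using assms(5) p(3) q(3) r(3) s(3) by auto
  from no_C8[OF this p(1,2) q(1,2) r(1,2) s(1,2)] show False .
qed

text \<open>By \<open>no_fat_C4\<close> two sets \<open>F a\<close> share at most one vertex, so
  \<open>sum_card_squares_le\<close> applies. The trivial bound on the linear sum gives the second
  \<open>n * n\<close>.\<close>

lemma sum_fat_degree_squares_le: "(\<Sum>a\<in>V. card (F a) * card (F a)) \<le> 2 * n * n"
proof -
  have F: "F a \<subseteq> V" for a
    by (auto simp: F_def)
  have "(\<Sum>a\<in>V. card (F a) * card (F a)) \<le> card V * card V + (\<Sum>a\<in>V. card (F a))"
  proof (rule sum_card_squares_le)
    fix a a' x y
    assume *: "a \<noteq> a'" "x \<in> F a \<inter> F a'" "y \<in> F a \<inter> F a'"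
    show "x = y"
    proof (rule ccontr)
      assume "x \<noteq> y"
      moreover have fats: "fat a x" "fat a y" "fat a' x" "fat a' y"
        using * by (auto simp: F_def)
      ultimately have "distinct [a, x, a', y]"
        using *(1) fats[THEN fat_neq] by auto
      then show False
        using no_fat_C4[of a x a' y] fats fat_sym[of x a'] fat_sym[of y a] by simp
    qed
  qed (simp_all add: F)
  also have "(\<Sum>a\<in>V. card (F a)) \<le> (\<Sum>a\<in>V. n)"
    by (intro sum_mono card_mono F finite_V)
  finally show ?thesis
    by simp
qed

text \<open>Otherwise \<open>v a x b w b' y a'\<close> is an 8-cycle, where \<open>x\<close> and
  \<open>y\<close> are fresh common neighbours of the two fat pairs.\<close>

lemma disjoint_fat_pairs_common_neighbour:
  assumes "fat a b" "fat a' b'" "distinct [a, b, a', b']"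
    and v: "v \<in> N a \<inter> N b \<inter> (N a' \<inter> N b')" and w: "w \<in> N a \<inter> N b \<inter> (N a' \<inter> N b')"
  shows "v = w"
proof (rule ccontr)
  assume "v \<noteq> w"
  obtain x where x: "adj a x" "adj x b" "x \<notin> set [a, b, a', b', v, w]"
    using fat_middle[OF assms(1), of "[a, b, a', b', v, w]"] by auto
  have "fat b' a'"
    using assms(2) fat_sym by blast
  then obtain y where y: "adj b' y" "adj y a'" "y \<notin> set [a, b, a', b', v, w, x]"
    using fat_middle[of b' a' "[a, b, a', b', v, w, x]"] by auto
  have vw: "adj v a" "adj b w" "adj w b'" "adj a' v" "adj a v" "adj b v" "adj b' v" "adj a w" "adj a' w"
    "adj b' w"
    using v w by (simp_all add: adj_sym)
  have "v \<notin> {a, b, a', b'}" "w \<notin> {a, b, a', b'}"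
    using vw by auto
  then have "distinct [v, a, x, b, w, b', y, a']"
    using \<open>v \<noteq> w\<close> assms(3) x(3) y(3) by auto
  from no_C8[OF this vw(1) x(1,2) vw(2,3) y(1,2) vw(4)] show False .
qed

section \<open>How different fat triangles can intersect\<close>

definition fat_triangle where
  "fat_triangle a b c \<longleftrightarrow> fat a b \<and> fat b c \<and> fat c a"

lemma fat_triangle_rotate: "fat_triangle a b c \<Longrightarrow> fat_triangle b c a"
  by (simp add: fat_triangle_def)

lemma fat_triangle_swap: "fat_triangle a b c \<Longrightarrow> fat_triangle b a c"
  using fat_sym by (auto simp: fat_triangle_def)

lemma fat_triangle_neq: "fat_triangle a b c \<Longrightarrow> a \<noteq> b \<and> b \<noteq> c \<and> c \<noteq> a"
  using fat_neq by (auto simp: fat_triangle_def)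

text \<open>Two third vertices over the same side would give the fat 4-cycle
  \<open>p r q s\<close>.\<close>

lemma fat_triangle_unique:
  assumes "fat_triangle p q r" "fat_triangle p q s"
  shows "r = s"
proof (rule ccontr)
  assume "r \<noteq> s"
  then have "distinct [p, r, q, s]"
    using fat_triangle_neq[OF assms(1)] fat_triangle_neq[OF assms(2)] by auto
  moreover have "fat p r" "fat r q" "fat q s" "fat s p"
    using assms fat_sym[of p r] fat_sym[of r q] by (auto simp: fat_triangle_def)
  ultimately show False
    using no_fat_C4 by blast
qed

text \<open>The fat pairs \<open>b c\<close>, \<open>c a\<close>, \<open>a b'\<close> subdivide to a
  path of length six from \<open>b\<close> to \<open>b'\<close>, which \<open>v\<close> closes to an
  8-cycle unless \<open>v\<close> is the vertex \<open>c\<close> on it.\<close>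

lemma fat_triangles_sharing_vertex:
  assumes T: "fat_triangle a b c" "fat_triangle a b' c'" and dist: "distinct [a, b, c, b', c']"
    and v: "adj v a" "adj v b" "adj v b'"
  shows "v = c"
proof (rule ccontr)
  assume "v \<noteq> c"
  have fats: "fat b c" "fat c a" "fat a b'"
    using T by (auto simp: fat_triangle_def)
  obtain x where x: "adj b x" "adj x c" "x \<notin> set [v, a, b, c, b']"
    using fat_middle[OF fats(1), of "[v, a, b, c, b']"] by auto
  obtain y where y: "adj c y" "adj y a" "y \<notin> set [v, a, b, c, b', x]"
    using fat_middle[OF fats(2), of "[v, a, b, c, b', x]"] by auto
  obtain z where z: "adj a z" "adj z b'" "z \<notin> set [v, a, b, c, b', x, y]"
    using fat_middle[OF fats(3), of "[v, a, b, c, b', x, y]"] by auto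
  have "v \<notin> {a, b, b'}"
    using v by auto
  then have "distinct [v, b, x, c, y, a, z, b']"
    using \<open>v \<noteq> c\<close> dist x(3) y(3) z(3) by auto
  moreover have "adj b' v"
    using v(3) adj_sym by blast
  ultimately show False
    using no_C8 v(2) x(1,2) y(1,2) z(1,2) by blast
qed

text \<open>By \<open>fat_triangle_unique\<close> any coincidence among \<open>b\<close>,
  \<open>c\<close>, \<open>b'\<close>, \<open>c'\<close> across the triangles would make the
  triangles equal. So the five vertices are distinct, and the preceding lemma forces both
  \<open>v\<close> and \<open>w\<close> to be \<open>c\<close>.\<close>

lemma fat_triangles_common_vertex:
  assumes T: "fat_triangle a b c" "fat_triangle a b' c'" and ne: "{a, b, c} \<noteq> {a, b', c'}"
    and v: "v \<in> N a \<inter> N b \<inter> (N a \<inter> N b')" and w: "w \<in> N a \<inter> N b \<inter> (N a \<inter> N b')"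
  shows "v = w"
proof -
  have "b \<noteq> b'"
    using fat_triangle_unique T ne by blast
  moreover have "c \<noteq> c'"
  proof
    assume "c = c'"
    then have "fat_triangle c a b" "fat_triangle c a b'"
      using T by (auto simp: fat_triangle_def)
    then show False
      using fat_triangle_unique \<open>b \<noteq> b'\<close> by blast
  qed
  moreover have "c \<noteq> b'"
  proof
    assume "c = b'"
    then have "fat_triangle a b' b" "fat_triangle a b' c'"
      using T fat_sym by (auto simp: fat_triangle_def)
    then have "b = c'"
      by (rule fat_triangle_unique)
    then show False
      using ne \<open>c = b'\<close> by auto
  qed
  moreover have "b \<noteq> c'"
  proof
    assume "b = c'"
    then have "fat_triangle a b c" "fat_triangle a b b'"
      using T fat_sym by (auto simp: fat_triangle_def)
    then have "c = b'"
      by (rule fat_triangle_unique)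
    then show False
      using \<open>c \<noteq> b'\<close> by simp
  qed
  ultimately have "distinct [a, b, c, b', c']"
    using fat_triangle_neq[OF T(1)] fat_triangle_neq[OF T(2)] by auto
  moreover have "adj v a" "adj v b" "adj v b'" "adj w a" "adj w b" "adj w b'"
    using v w by (simp_all add: adj_sym)
  ultimately have "v = c" "w = c"
    using fat_triangles_sharing_vertex[OF T] by blast+
  then show ?thesis
    by simp
qed

text \<open>Provides the almost disjointness needed for \<open>sum_card_squares_le\<close>. If the
  sides \<open>a b\<close> and \<open>a' b'\<close> meet, swapping their ends brings a shared vertex
  to the front; otherwise the lemma on disjoint fat pairs applies, whether or not the third vertices
  coincide.\<close>

lemma fat_triangles_common_neighbour:
  assumes T: "fat_triangle a b c" and T': "fat_triangle a' b' c'" and ne: "{a, b, c} \<noteq> {a', b', c'}"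
    and v: "v \<in> N a \<inter> N b \<inter> (N a' \<inter> N b')" and w: "w \<in> N a \<inter> N b \<inter> (N a' \<inter> N b')"
  shows "v = w"
proof -
  note swap = fat_triangle_swap[OF T] fat_triangle_swap[OF T']
  consider "a = a'" | "a = b'" | "b = a'" | "b = b'" | "{a, b} \<inter> {a', b'} = {}"
    by blast
  then show ?thesis
  proof cases
    case 1
    then show ?thesis
      using fat_triangles_common_vertex[of a b c b' c' v w] T T' ne v w by simp
  next
    case 2
    then show ?thesis
      using fat_triangles_common_vertex[of a b c a' c' v w] T swap ne v w
      by (simp add: insert_commute)
  next
    case 3
    then show ?thesis
      using fat_triangles_common_vertex[of b a c b' c' v w] T' swap ne v w
      by (simp add: insert_commute)
  next
    case 4
    then show ?thesis
      using fat_triangles_common_vertex[of b a c a' c' v w] swap ne v w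
      by (simp add: insert_commute)
  next
    case 5
    then have "distinct [a, b, a', b']"
      using fat_triangle_neq[OF T] fat_triangle_neq[OF T'] by auto
    moreover have "fat a b" "fat a' b'"
      using T T' by (auto simp: fat_triangle_def)
    ultimately show ?thesis
      using disjoint_fat_pairs_common_neighbour v w by blast
  qed
qed

section \<open>Counting 6-cycles\<close>

text \<open>The two thin pairs come from different triangles of second neighbours, and their middles
  \<open>v1\<close> and \<open>v4\<close> are opposite vertices of the 6-cycle.\<close>

definition thin_opposite where
  "thin_opposite = {(v0, v1, v2, v3, v4, v5). hexagon v0 v1 v2 v3 v4 v5 \<and>
    \<not> fat v0 v2 \<and> \<not> fat v3 v5}"

definition one_thin where
  "one_thin = {(v0, v1, v2, v3, v4, v5). hexagon v0 v1 v2 v3 v4 v5 \<and>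
    \<not> fat v0 v2 \<and> fat v2 v4 \<and> fat v4 v0}"

definition none_thin where
  "none_thin = {(v0, v1, v2, v3, v4, v5). hexagon v0 v1 v2 v3 v4 v5 \<and> fat_triangle v0 v2 v4}"

lemma copies_C6_subset:
  "copies (cycle_graph 6) G \<subseteq>
    hexagon_graph ` thin_opposite \<union> hexagon_graph ` one_thin \<union> hexagon_graph ` none_thin"
proof
  fix H assume "H \<in> copies (cycle_graph 6) G"
  then obtain v0 v1 v2 v3 v4 v5 where hex0: "hexagon v0 v1 v2 v3 v4 v5"
    and H0: "H = hexagon_graph (v0, v1, v2, v3, v4, v5)"
    by (rule copies_C6)
  let ?Q = "\<lambda>v0 v1 v2 v3 v4 v5. \<not> fat v0 v2 \<and> \<not> fat v3 v5 \<or>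
    \<not> fat v0 v2 \<and> fat v2 v4 \<and> fat v4 v0 \<or> fat v0 v2 \<and> fat v2 v4 \<and> fat v4 v0"
  let ?W = "hexagon_graph ` thin_opposite \<union> hexagon_graph ` one_thin \<union> hexagon_graph ` none_thin"
  have good: "hexagon_graph (w0, w1, w2, w3, w4, w5) \<in> ?W"
    if "hexagon w0 w1 w2 w3 w4 w5" "?Q w0 w1 w2 w3 w4 w5" for w0 w1 w2 w3 w4 w5
  proof -
    have "(w0, w1, w2, w3, w4, w5) \<in> thin_opposite \<union> one_thin \<union> none_thin"
      using that unfolding thin_opposite_def one_thin_def none_thin_def fat_triangle_def by simp
    then show ?thesis
      by blast
  qed
  note hex1 = hexagon_rotate[OF hex0]
  note hex2 = hexagon_rotate[OF hex1]
  note hex3 = hexagon_rotate[OF hex2]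
  note hex4 = hexagon_rotate[OF hex3]
  note hex5 = hexagon_rotate[OF hex4]
  have H1: "H = hexagon_graph (v1, v2, v3, v4, v5, v0)"
    unfolding H0 by (rule hexagon_graph_rotate[symmetric])
  have H2: "H = hexagon_graph (v2, v3, v4, v5, v0, v1)"
    unfolding H1 by (rule hexagon_graph_rotate[symmetric])
  have H3: "H = hexagon_graph (v3, v4, v5, v0, v1, v2)"
    unfolding H2 by (rule hexagon_graph_rotate[symmetric])
  have H4: "H = hexagon_graph (v4, v5, v0, v1, v2, v3)"
    unfolding H3 by (rule hexagon_graph_rotate[symmetric])
  have H5: "H = hexagon_graph (v5, v0, v1, v2, v3, v4)"
    unfolding H4 by (rule hexagon_graph_rotate[symmetric])
  \<comment> \<open>If neither triangle has at most one thin side, then each has at least two. The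
    sides form three opposite pairs, one side from each triangle, so some opposite pair is thin
    twice. Rotations keep the orientation of every side, which makes the claim
    propositional.\<close>
  have "?Q v0 v1 v2 v3 v4 v5 \<or> ?Q v1 v2 v3 v4 v5 v0 \<or> ?Q v2 v3 v4 v5 v0 v1 \<or>
    ?Q v3 v4 v5 v0 v1 v2 \<or> ?Q v4 v5 v0 v1 v2 v3 \<or> ?Q v5 v0 v1 v2 v3 v4"
    by argo
  then show "H \<in> ?W"
    using good[OF hex0, folded H0] good[OF hex1, folded H1] good[OF hex2, folded H2]
      good[OF hex3, folded H3] good[OF hex4, folded H4] good[OF hex5, folded H5]
    by argo
qed

text \<open>The empty set for the pairs that are not thin makes a bound by \<open>K\<close> hold unconditionally.\<close>
definition thin_middles where
  "thin_middles a b = (if a = b \<or> fat a b then {} else N a \<inter> N b)"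

lemma finite_thin_middles [simp]: "finite (thin_middles a b)"
  by (simp add: thin_middles_def)

lemma card_thin_middles_le: "card (thin_middles a b) \<le> K"
  by (auto simp: thin_middles_def fat_def codeg_def)

text \<open>Choose \<open>v0\<close>, then the edge \<open>v2 v3\<close> in
  \<open>two_paths v0\<close>, then \<open>v5\<close> in \<open>N v0\<close>. The vertices
  \<open>v1\<close> and \<open>v4\<close> are middles of thin pairs and leave at most
  \<open>K\<close> choices each.\<close>

lemma card_thin_opposite_le:
  "card thin_opposite \<le> 48 * n * K * K * (\<Sum>v\<in>V. card (N v))"
  "finite thin_opposite"
proof -
  define Z where "Z = (SIGMA v0:V. SIGMA p:two_paths v0. SIGMA v5:N v0.
    thin_middles v0 (fst p) \<times> thin_middles (snd p) v5)"
  have fin: "finite Z"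
    unfolding Z_def by (intro finite_SigmaI) simp_all
  have "thin_opposite \<subseteq> (\<lambda>(v0, (v2, v3), v5, v1, v4). (v0, v1, v2, v3, v4, v5)) ` Z"
  proof
    fix t assume "t \<in> thin_opposite"
    then obtain v0 v1 v2 v3 v4 v5 where t: "t = (v0, v1, v2, v3, v4, v5)"
      and hex: "hexagon v0 v1 v2 v3 v4 v5" and thin: "\<not> fat v0 v2" "\<not> fat v3 v5"
      by (auto simp: thin_opposite_def)
    have adjs: "adj v0 v1" "adj v2 v1" "adj v2 v3" "adj v3 v4" "adj v5 v4" "adj v0 v5"
      and neq: "v2 \<noteq> v0" "v3 \<noteq> v0" "v0 \<noteq> v2" "v3 \<noteq> v5"
      using hex adj_sym[of v1 v2] adj_sym[of v4 v5] adj_sym[of v5 v0] by (auto simp: hexagon_def)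
    have "v0 \<in> V"
      using hexagon_verts[OF hex] by blast
    moreover have "N v0 \<inter> N v2 \<noteq> {}"
      using adjs by (auto intro!: exI[of _ v1])
    ultimately have "(v0, (v2, v3), v5, v1, v4) \<in> Z"
      using adjs neq thin by (simp add: Z_def two_paths_def thin_middles_def)
    then show "t \<in> (\<lambda>(v0, (v2, v3), v5, v1, v4). (v0, v1, v2, v3, v4, v5)) ` Z"
      by (rule rev_image_eqI) (simp add: t)
  qed
  then show "finite thin_opposite"
    using fin finite_surj by blast
  have "card thin_opposite \<le> card Z"
    using \<open>thin_opposite \<subseteq> _\<close> fin by (rule surj_card_le[rotated])
  also have "card Z = (\<Sum>v\<in>V. \<Sum>p\<in>two_paths v. \<Sum>w\<in>N v.
      card (thin_middles v (fst p)) * card (thin_middles (snd p) w))"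
    unfolding Z_def by (simp add: card_cartesian_product)
  also have "\<dots> \<le> (\<Sum>v\<in>V. \<Sum>p\<in>two_paths v. \<Sum>w\<in>N v. K * K)"
    by (intro sum_mono mult_le_mono card_thin_middles_le)
  also have "\<dots> = (\<Sum>v\<in>V. card (two_paths v) * (card (N v) * (K * K)))"
    by simp
  also have "\<dots> \<le> (\<Sum>v\<in>V. 48 * n * (card (N v) * (K * K)))"
    by (intro sum_mono mult_le_mono1 card_two_paths_le)
  also have "\<dots> = 48 * n * K * K * (\<Sum>v\<in>V. card (N v))"
    by (simp add: sum_distrib_left mult_ac)
  finally show "card thin_opposite \<le> 48 * n * K * K * (\<Sum>v\<in>V. card (N v))" .
qed

lemma finite_F [simp]: "finite (F a)"
  by (simp add: F_def)

text \<open>Around the vertex \<open>v4\<close> opposite the thin side, \<open>v3 v2\<close> and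
  \<open>v5 v0\<close> are edges from \<open>N v4\<close> to \<open>F v4\<close>, of which there are
  linearly many in the two degrees; \<open>v1\<close> has at most \<open>K\<close> choices. Squaring
  and summing gives the constant 128 * (17 + 2) = 2432.\<close>

lemma card_one_thin_le:
  "card one_thin \<le> 2432 * K * n * n"
  "finite one_thin"
proof -
  define Q where "Q a = {(s, b). s \<in> N a \<and> b \<in> F a \<and> adj s b}" for a
  have finQ [simp]: "finite (Q a)" for a
    by (rule finite_subset[of _ "N a \<times> F a"]) (auto simp: Q_def)
  have Q: "card (Q a) \<le> 8 * (card (N a) + card (F a))" for a
    unfolding Q_def by (rule card_edges_nbhd_le) (auto simp: F_def fat_def)
  define Z where "Z = (SIGMA v4:V. SIGMA p:Q v4. SIGMA q:Q v4. thin_middles (snd q) (snd p))"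
  have fin: "finite Z"
    unfolding Z_def by (intro finite_SigmaI) simp_all
  have "one_thin \<subseteq> (\<lambda>(v4, (v3, v2), (v5, v0), v1). (v0, v1, v2, v3, v4, v5)) ` Z"
  proof
    fix t assume "t \<in> one_thin"
    then obtain v0 v1 v2 v3 v4 v5 where t: "t = (v0, v1, v2, v3, v4, v5)"
      and hex: "hexagon v0 v1 v2 v3 v4 v5" and fats: "\<not> fat v0 v2" "fat v4 v2" "fat v4 v0"
      by (auto simp: one_thin_def fat_sym)
    have adjs: "adj v0 v1" "adj v2 v1" "adj v3 v2" "adj v4 v3" "adj v4 v5" "adj v5 v0"
      and neq: "v0 \<noteq> v2"
      using hex adj_sym[of v1 v2] adj_sym[of v2 v3] adj_sym[of v3 v4] by (auto simp: hexagon_def)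
    have "(v4, (v3, v2), (v5, v0), v1) \<in> Z"
      using adjs neq fats hexagon_verts[OF hex] by (simp add: Z_def Q_def F_def thin_middles_def)
    then show "t \<in> (\<lambda>(v4, (v3, v2), (v5, v0), v1). (v0, v1, v2, v3, v4, v5)) ` Z"
      by (rule rev_image_eqI) (simp add: t)
  qed
  then show "finite one_thin"
    using fin finite_surj by blast
  have "card one_thin \<le> card Z"
    using \<open>one_thin \<subseteq> _\<close> fin by (rule surj_card_le[rotated])
  also have "card Z = (\<Sum>a\<in>V. \<Sum>p\<in>Q a. \<Sum>q\<in>Q a. card (thin_middles (snd q) (snd p)))"
    unfolding Z_def by simp
  also have "\<dots> \<le> (\<Sum>a\<in>V. \<Sum>p\<in>Q a. \<Sum>q\<in>Q a. K)"
    by (intro sum_mono card_thin_middles_le)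
  also have "\<dots> = (\<Sum>a\<in>V. card (Q a) * card (Q a) * K)"
    by (simp add: mult_ac)
  also have "\<dots> \<le> (\<Sum>a\<in>V. 128 * (card (N a) * card (N a) + card (F a) * card (F a)) * K)"
  proof (intro sum_mono mult_le_mono1)
    fix a
    have sq: "64 * ((x + y) * (x + y)) \<le> 128 * (x * x + y * y)" for x y :: nat
    proof -
      have "int (64 * ((x + y) * (x + y))) \<le> int (128 * (x * x + y * y))"
        using zero_le_power2[of "int x - int y"] by (simp add: power2_eq_square algebra_simps)
      then show ?thesis
        by linarith
    qed
    have "card (Q a) * card (Q a) \<le> (8 * (card (N a) + card (F a))) * (8 * (card (N a) + card (F a)))"
      by (intro mult_le_mono Q)
    also have "\<dots> = 64 * ((card (N a) + card (F a)) * (card (N a) + card (F a)))"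
      by (simp add: algebra_simps)
    also note sq
    finally show "card (Q a) * card (Q a) \<le> 128 * (card (N a) * card (N a) + card (F a) * card (F a))" .
  qed
  also have "\<dots> = 128 * ((\<Sum>a\<in>V. card (N a) * card (N a)) + (\<Sum>a\<in>V. card (F a) * card (F a))) * K"
    by (simp add: sum_distrib_left sum_distrib_right sum.distrib[symmetric])
  also have "\<dots> \<le> 128 * (17 * n * n + 2 * n * n) * K"
    by (intro mult_le_mono1 mult_le_mono2 add_mono sum_degree_squares_le sum_fat_degree_squares_le)
  finally show "card one_thin \<le> 2432 * K * n * n"
    by (simp add: algebra_simps)
qed

text \<open>A fat triangle with largest codegree \<open>m\<close> carries at most
  \<open>\<beta> * m * m\<close> copies, and the sum of the squares \<open>m * m\<close> is at most
  \<open>K / (K - 1)\<close> times \<open>n * n\<close>. The factor \<open>K - 1\<close> is kept on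
  the left to avoid division.\<close>

lemma card_none_thin_le:
  fixes \<beta> :: real
  assumes \<beta>: "\<And>a b c. fat_triangle a b c \<Longrightarrow>
    real (codeg a b) < \<beta> \<or> real (codeg b c) < \<beta> \<or> real (codeg c a) < \<beta>"
    and "0 \<le> \<beta>"
  shows "real (K - 1) * real (card (hexagon_graph ` none_thin)) \<le> \<beta> * (real K * (real n)\<^sup>2)"
    and "finite (hexagon_graph ` none_thin)"
proof -
  \<comment> \<open>Triangles are sets here, since counting all six orderings would spoil the
    leading constant.\<close>
  define \<T> where "\<T> = {{a, b, c} | a b c. fat_triangle a b c}"
  have "\<exists>a b c. T = {a, b, c} \<and> fat_triangle a b c \<and> codeg b c \<le> codeg a b \<and> codeg c a \<le> codeg a b"
    if T: "T \<in> \<T>" for T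
  proof -
    obtain a b c where abc: "T = {a, b, c}" "fat_triangle a b c"
      using T by (auto simp: \<T>_def)
    then have eqs: "T = {b, c, a}" "T = {c, a, b}"
      by auto
    note rot = fat_triangle_rotate[OF abc(2)] fat_triangle_rotate[OF fat_triangle_rotate[OF abc(2)]]
    consider "codeg b c \<le> codeg a b \<and> codeg c a \<le> codeg a b"
      | "codeg c a \<le> codeg b c \<and> codeg a b \<le> codeg b c"
      | "codeg a b \<le> codeg c a \<and> codeg b c \<le> codeg c a"
      by linarith
    then show ?thesis
      by cases (use abc eqs rot in blast)+
  qed
  then have "\<forall>T\<in>\<T>. \<exists>t. case t of (a, b, c) \<Rightarrow> T = {a, b, c} \<and> fat_triangle a b c \<and>
      codeg b c \<le> codeg a b \<and> codeg c a \<le> codeg a b"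
    by simp
  \<comment> \<open>\<open>r\<close> orders each triangle so that the side of largest codegree comes
    first.\<close>
  from bchoice[OF this] obtain r where r_all: "\<forall>T\<in>\<T>. case r T of (a, b, c) \<Rightarrow>
      T = {a, b, c} \<and> fat_triangle a b c \<and> codeg b c \<le> codeg a b \<and> codeg c a \<le> codeg a b"
    by blast
  have r: "T = {a, b, c} \<and> fat_triangle a b c \<and> codeg b c \<le> codeg a b \<and> codeg c a \<le> codeg a b"
    if "T \<in> \<T>" "r T = (a, b, c)" for T a b c
    using bspec[OF r_all that(1)] unfolding that(2) by simp
  define S where "S T = (case r T of (a, b, c) \<Rightarrow> N a \<inter> N b)" for T
  have "\<T> \<subseteq> Pow V"
    using fat_verts by (auto simp: \<T>_def fat_triangle_def)
  then have fin\<T>: "finite \<T>"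
    using finite_V finite_subset by blast
  \<comment> \<open>Triples of middles, one for each side. Triples with repetitions are included, as
    only an upper bound is wanted.\<close>
  define W where "W T = (case r T of (a, b, c) \<Rightarrow> (N a \<inter> N b) \<times> (N b \<inter> N c) \<times> (N c \<inter> N a))" for T
  define \<psi> where "\<psi> T = (case r T of (a, b, c) \<Rightarrow> \<lambda>(x, y, z). hexagon_graph (a, x, b, y, c, z))" for T
  have finW: "finite (W T)" for T
    by (simp add: W_def split: prod.split)
  have sub: "hexagon_graph ` none_thin \<subseteq> (\<Union>T\<in>\<T>. \<psi> T ` W T)"
  proof
    fix H assume "H \<in> hexagon_graph ` none_thin"
    then obtain v0 v1 v2 v3 v4 v5 where H: "H = hexagon_graph (v0, v1, v2, v3, v4, v5)"
      and hex: "hexagon v0 v1 v2 v3 v4 v5" and tri: "fat_triangle v0 v2 v4"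
      by (auto simp: none_thin_def)
    have T: "{v0, v2, v4} \<in> \<T>"
      using tri by (auto simp: \<T>_def)
    obtain a b c where rT: "r {v0, v2, v4} = (a, b, c)"
      by (rule prod_cases3)
    have abc: "{v0, v2, v4} = {a, b, c}" and dist: "a \<noteq> b" "b \<noteq> c" "c \<noteq> a"
      using r[OF T rT] fat_triangle_neq by auto
    have adjs: "adj v0 v1" "adj v1 v0" "adj v2 v1" "adj v1 v2" "adj v2 v3" "adj v3 v2" "adj v3 v4"
      "adj v4 v3" "adj v4 v5" "adj v5 v4" "adj v5 v0" "adj v0 v5"
      using hex adj_sym by (simp_all add: hexagon_def)
    have H2: "H = hexagon_graph (v2, v3, v4, v5, v0, v1)"
      unfolding H by (rule hexagon_graph_rotate2[symmetric])
    have H4: "H = hexagon_graph (v4, v5, v0, v1, v2, v3)"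
      unfolding H2 by (rule hexagon_graph_rotate2[symmetric])
    have H'0: "H = hexagon_graph (v0, v5, v4, v3, v2, v1)"
      unfolding H by (rule hexagon_graph_reverse[symmetric])
    have H'2: "H = hexagon_graph (v2, v1, v0, v5, v4, v3)"
      unfolding H2 by (rule hexagon_graph_reverse[symmetric])
    have H'4: "H = hexagon_graph (v4, v3, v2, v1, v0, v5)"
      unfolding H4 by (rule hexagon_graph_reverse[symmetric])
    have "v0 \<in> {a, b, c}" "v2 \<in> {a, b, c}" "v4 \<in> {a, b, c}"
      using abc by blast+
    moreover have "v0 \<noteq> v2" "v2 \<noteq> v4" "v4 \<noteq> v0"
      using fat_triangle_neq[OF tri] by auto
    \<comment> \<open>The order chosen by \<open>r\<close> may be any of the six; it is reached by
      rotating the 6-cycle by two steps and possibly reversing it.\<close>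
    ultimately consider "v0 = a" "v2 = b" "v4 = c" | "v0 = b" "v2 = c" "v4 = a"
      | "v0 = c" "v2 = a" "v4 = b" | "v0 = a" "v2 = c" "v4 = b" | "v0 = b" "v2 = a" "v4 = c"
      | "v0 = c" "v2 = b" "v4 = a"
      by blast
    then have "\<exists>x y z. (x, y, z) \<in> (N a \<inter> N b) \<times> (N b \<inter> N c) \<times> (N c \<inter> N a) \<and>
        H = hexagon_graph (a, x, b, y, c, z)"
    proof cases
      case 1
      then show ?thesis
        using adjs H by (intro exI[of _ v1] exI[of _ v3] exI[of _ v5]) simp
    next
      case 2
      then show ?thesis
        using adjs H4 by (intro exI[of _ v5] exI[of _ v1] exI[of _ v3]) simp
    next
      case 3
      then show ?thesis
        using adjs H2 by (intro exI[of _ v3] exI[of _ v5] exI[of _ v1]) simp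
    next
      case 4
      then show ?thesis
        using adjs H'0 by (intro exI[of _ v5] exI[of _ v3] exI[of _ v1]) simp
    next
      case 5
      then show ?thesis
        using adjs H'2 by (intro exI[of _ v1] exI[of _ v5] exI[of _ v3]) simp
    next
      case 6
      then show ?thesis
        using adjs H'4 by (intro exI[of _ v3] exI[of _ v1] exI[of _ v5]) simp
    qed
    then obtain x y z where "(x, y, z) \<in> W {v0, v2, v4}" "H = \<psi> {v0, v2, v4} (x, y, z)"
      by (auto simp: W_def \<psi>_def rT)
    then show "H \<in> (\<Union>T\<in>\<T>. \<psi> T ` W T)"
      using T by blast
  qed
  then show "finite (hexagon_graph ` none_thin)"
    by (rule finite_subset) (simp add: fin\<T> finW)
  have "card (hexagon_graph ` none_thin) \<le> card (\<Union>T\<in>\<T>. \<psi> T ` W T)"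
    using fin\<T> finW by (intro card_mono sub) auto
  also have "\<dots> \<le> (\<Sum>T\<in>\<T>. card (\<psi> T ` W T))"
    using fin\<T> by (rule card_UN_le)
  also have "\<dots> \<le> (\<Sum>T\<in>\<T>. card (W T))"
    by (intro sum_mono card_image_le finW)
  finally have le1: "real (card (hexagon_graph ` none_thin)) \<le> (\<Sum>T\<in>\<T>. real (card (W T)))"
    by (metis of_nat_le_iff of_nat_sum)
  have W_le: "real (card (W T)) \<le> \<beta> * real (card (S T) * card (S T))" and S_ge: "K \<le> card (S T)"
    if T: "T \<in> \<T>" for T
  proof -
    obtain a b c where rT: "r T = (a, b, c)"
      by (rule prod_cases3)
    note abc = r[OF T rT]
    have S: "card (S T) = codeg a b"
      by (simp add: S_def rT codeg_def)
    show "K \<le> card (S T)"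
      unfolding S using abc by (simp add: fat_triangle_def fat_def)
    have W: "card (W T) = codeg a b * (codeg b c * codeg c a)"
      by (simp add: W_def rT codeg_def card_cartesian_product)
    have prod_le: "real (codeg a b) * (x * y) \<le> \<beta> * (real (codeg a b) * real (codeg a b))"
      if "x \<le> \<beta>" "y \<le> real (codeg a b)" "0 \<le> y" for x y :: real
    proof -
      have "x * y \<le> \<beta> * real (codeg a b)"
        using that assms(2) by (intro mult_mono) auto
      then have "real (codeg a b) * (x * y) \<le> real (codeg a b) * (\<beta> * real (codeg a b))"
        by (rule mult_left_mono) simp
      then show ?thesis
        by (simp add: mult_ac)
    qed
    \<comment> \<open>If the side \<open>a b\<close> is the one below \<open>\<beta>\<close>, so are
      the others, because its codegree is the largest.\<close>
    have "real (codeg b c) < \<beta> \<or> real (codeg c a) < \<beta>"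
      using \<beta>[of a b c] abc by auto
    then have "real (codeg a b) * (real (codeg b c) * real (codeg c a)) \<le>
        \<beta> * (real (codeg a b) * real (codeg a b))"
    proof
      assume "real (codeg b c) < \<beta>"
      then show ?thesis
        using abc by (intro prod_le) auto
    next
      assume "real (codeg c a) < \<beta>"
      then have "real (codeg a b) * (real (codeg c a) * real (codeg b c)) \<le>
          \<beta> * (real (codeg a b) * real (codeg a b))"
        using abc by (intro prod_le) auto
      then show ?thesis
        by (simp add: mult.commute)
    qed
    then show "real (card (W T)) \<le> \<beta> * real (card (S T) * card (S T))"
      unfolding W S of_nat_mult .
  qed
  define s where "s = (\<Sum>T\<in>\<T>. card (S T) * card (S T))"
  have "s \<le> n * n + (\<Sum>T\<in>\<T>. card (S T))"
    unfolding s_def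
  proof (rule sum_card_squares_le[OF fin\<T> finite_V])
    fix T assume "T \<in> \<T>"
    show "S T \<subseteq> V"
      using N_subset by (auto simp: S_def split: prod.split)
  next
    fix T T' x y
    assume TT: "T \<in> \<T>" "T' \<in> \<T>" "T \<noteq> T'" and xy: "x \<in> S T \<inter> S T'" "y \<in> S T \<inter> S T'"
    obtain a b c where rT: "r T = (a, b, c)"
      by (rule prod_cases3)
    obtain a' b' c' where rT': "r T' = (a', b', c')"
      by (rule prod_cases3)
    have S: "S T = N a \<inter> N b" "S T' = N a' \<inter> N b'"
      by (simp_all add: S_def rT rT')
    show "x = y"
      using fat_triangles_common_neighbour[of a b c a' b' c' x y] r[OF TT(1) rT] r[OF TT(2) rT']
        TT(3) xy unfolding S by blast
  qed
  \<comment> \<open>Every \<open>card (S T)\<close> is at least \<open>K\<close>, so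
    \<open>K\<close> times the linear sum is at most \<open>s\<close> and is absorbed on the left,
    leaving the factor \<open>K - 1\<close>.\<close>
  then have "K * s \<le> K * (n * n) + K * (\<Sum>T\<in>\<T>. card (S T))"
    by (metis add_mult_distrib2 mult_le_mono2)
  also have "K * (\<Sum>T\<in>\<T>. card (S T)) \<le> s"
    unfolding s_def sum_distrib_left by (intro sum_mono mult_le_mono1 S_ge)
  finally have "(K - 1) * s \<le> K * (n * n)"
    by (simp add: diff_mult_distrib)
  then have "real (K - 1) * real s \<le> real K * (real n)\<^sup>2"
    unfolding of_nat_mult[symmetric] power2_eq_square by (rule of_nat_mono)
  then have s_le: "\<beta> * (real (K - 1) * real s) \<le> \<beta> * (real K * (real n)\<^sup>2)"
    using assms(2) by (rule mult_left_mono)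
  have "(\<Sum>T\<in>\<T>. real (card (W T))) \<le> (\<Sum>T\<in>\<T>. \<beta> * real (card (S T) * card (S T)))"
    by (intro sum_mono W_le)
  also have "\<dots> = \<beta> * real s"
    by (simp add: s_def sum_distrib_left)
  finally have "real (card (hexagon_graph ` none_thin)) \<le> \<beta> * real s"
    using le1 by linarith
  then have "real (K - 1) * real (card (hexagon_graph ` none_thin)) \<le> real (K - 1) * (\<beta> * real s)"
    by (rule mult_left_mono) simp
  also have "\<dots> = \<beta> * (real (K - 1) * real s)"
    by (simp only: mult_ac)
  finally show "real (K - 1) * real (card (hexagon_graph ` none_thin)) \<le> \<beta> * (real K * (real n)\<^sup>2)"
    using s_le by linarith
qed

text \<open>Adds up the three classes of 6-cycles. Only the last is cubic in \<open>n\<close> when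
  \<open>\<beta>\<close> is linear; the coefficient 240 is 48 * 5, with 5 from
  \<open>sum_degree_le\<close>.\<close>

lemma num_copies_C6_le:
  fixes \<beta> :: real
  assumes \<beta>: "\<And>a b c. fat_triangle a b c \<Longrightarrow>
    real (codeg a b) < \<beta> \<or> real (codeg b c) < \<beta> \<or> real (codeg c a) < \<beta>"
    and "0 \<le> \<beta>"
  shows "real (K - 1) * real (num_copies (cycle_graph 6) G) \<le>
    real (K - 1) * (240 * (real K)\<^sup>2 * ((real n)\<^sup>2 * sqrt (real n)) + 2432 * real K * (real n)\<^sup>2) +
    \<beta> * (real K * (real n)\<^sup>2)"
proof -
  let ?X = "hexagon_graph ` thin_opposite" and ?Y = "hexagon_graph ` one_thin"
    and ?Z = "hexagon_graph ` none_thin"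
  have Z: "real (K - 1) * real (card ?Z) \<le> \<beta> * (real K * (real n)\<^sup>2)" "finite ?Z"
    using card_none_thin_le[of \<beta>] assms by blast+
  note fin = card_thin_opposite_le(2) card_one_thin_le(2) Z(2)
  have "card (copies (cycle_graph 6) G) \<le> card (?X \<union> ?Y \<union> ?Z)"
    using copies_C6_subset fin by (intro card_mono) auto
  also have "\<dots> \<le> card ?X + card ?Y + card ?Z"
    using card_Un_le[of "?X \<union> ?Y" ?Z] card_Un_le[of ?X ?Y] by linarith
  also have "\<dots> \<le> card thin_opposite + card one_thin + card ?Z"
    using card_image_le[OF fin(1), of hexagon_graph] card_image_le[OF fin(2), of hexagon_graph] by linarith
  finally have "real (num_copies (cycle_graph 6) G) \<le>
      real (card thin_opposite) + real (card one_thin) + real (card ?Z)"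
    unfolding num_copies_def of_nat_add[symmetric] by (rule of_nat_mono)
  moreover have "real (card one_thin) \<le> 2432 * real K * (real n)\<^sup>2"
    using of_nat_mono[OF card_one_thin_le(1), where 'a = real] by (simp add: power2_eq_square mult_ac)
  moreover have "real (card thin_opposite) \<le> 240 * (real K)\<^sup>2 * ((real n)\<^sup>2 * sqrt (real n))"
  proof -
    have "real (card thin_opposite) \<le> real (48 * n * K * K * (\<Sum>v\<in>V. card (N v)))"
      by (rule of_nat_mono[OF card_thin_opposite_le(1)])
    also have "\<dots> = real (48 * n * K * K) * real (\<Sum>v\<in>V. card (N v))"
      by (rule of_nat_mult)
    also have "\<dots> \<le> real (48 * n * K * K) * (5 * real n * sqrt (real n))"
      by (rule mult_left_mono[OF sum_degree_le]) simp
    also have "\<dots> = 240 * (real K)\<^sup>2 * ((real n)\<^sup>2 * sqrt (real n))"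
      by (simp add: power2_eq_square)
    finally show ?thesis .
  qed
  ultimately have "real (num_copies (cycle_graph 6) G) \<le>
      240 * (real K)\<^sup>2 * ((real n)\<^sup>2 * sqrt (real n)) + 2432 * real K * (real n)\<^sup>2 + real (card ?Z)"
    by linarith
  then have "real (K - 1) * real (num_copies (cycle_graph 6) G) \<le> real (K - 1) *
      (240 * (real K)\<^sup>2 * ((real n)\<^sup>2 * sqrt (real n)) + 2432 * real K * (real n)\<^sup>2 + real (card ?Z))"
    by (rule mult_left_mono) simp
  then show ?thesis
    using Z(1) unfolding distrib_left by linarith
qed

text \<open>Inclusion-exclusion for \<open>N a \<inter> N b\<close> and
  \<open>N b \<inter> N c\<close> inside \<open>V\<close>; two sides of the triangle
  suffice.\<close>

lemma large_common_neighbourhood: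
  fixes \<beta> :: real
  assumes "fat_triangle a b c" "\<beta> \<le> real (codeg a b)" "\<beta> \<le> real (codeg b c)"
  shows "2 * \<beta> - real n \<le> real (card (N a \<inter> N b \<inter> N c))"
proof -
  have "card ((N a \<inter> N b) \<union> (N b \<inter> N c)) \<le> n"
    using N_subset by (intro card_mono) auto
  moreover have "card (N a \<inter> N b) + card (N b \<inter> N c) =
      card ((N a \<inter> N b) \<union> (N b \<inter> N c)) + card ((N a \<inter> N b) \<inter> (N b \<inter> N c))"
    by (rule card_Un_Int) simp_all
  moreover have "(N a \<inter> N b) \<inter> (N b \<inter> N c) = N a \<inter> N b \<inter> N c"
    by blast
  ultimately have "codeg a b + codeg b c \<le> n + card (N a \<inter> N b \<inter> N c)"
    by (simp add: codeg_def)
  then show ?thesis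
    using assms(2,3) by linarith
qed

end

section \<open>Asymptotics\<close>

text \<open>The binomial part of \<open>R n\<close> is the product of \<open>n - 3\<close>,
  \<open>n - 4\<close> and \<open>n - 5\<close>, each factor being at least
  \<open>n - 5\<close>.\<close>

lemma cube_le_R:
  assumes "n \<ge> 5"
  shows "(real n - 5) ^ 3 \<le> real (R n)"
proof -
  define m where "m = n - 5"
  have m: "n = m + 5"
    using assms by (simp add: m_def)
  have "3 * (Suc (Suc m) choose 3) = Suc (Suc m) * (Suc m choose 2)"
    using Suc_times_binomial[of 2 "Suc m"] by (simp add: numeral_3_eq_3 numeral_2_eq_2)
  moreover have "2 * (Suc m choose 2) = Suc m * m"
    using Suc_times_binomial[of 1 m] by (simp add: numeral_2_eq_2)
  ultimately have "6 * (Suc (Suc m) choose 3) = Suc (Suc m) * (Suc m * m)"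
    by (metis mult.assoc mult.left_commute numeral_Bit0_eq_double)
  then have "R n = Suc (Suc m) * (Suc m * m) + 12 * m"
    by (simp add: R_def m)
  moreover have "m * (m * m) \<le> Suc (Suc m) * (Suc m * m)"
    by (intro mult_le_mono) simp_all
  ultimately have "m ^ 3 \<le> R n"
    by (simp add: power3_eq_cube)
  then have "real m ^ 3 \<le> real (R n)"
    unfolding of_nat_power[symmetric] by (rule of_nat_mono)
  then show ?thesis
    by (simp add: m)
qed

text \<open>The gap \<open>d * real n ^ 3\<close> dominates all terms of order at most 5/2.\<close>

lemma eventually_less_cube:
  fixes d A B :: real
  assumes "0 < d"
  shows "\<forall>\<^sub>F n in sequentially.
    A * ((real n)\<^sup>2 * sqrt (real n)) + B * (real n)\<^sup>2 + (1 - d) * real n ^ 3 < (real n - 5) ^ 3"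
  using assms by real_asymp

section \<open>Choice of the constants and conclusion\<close>

theorem lemma2p11:
  "\<forall>\<delta>::real. \<delta> > 0 \<longrightarrow>
     (\<exists>\<rho>::real. \<rho> > 0 \<and>
       (\<exists>n0::nat. \<forall>n\<ge>n0. \<forall>G::'a graph.
          simple_graph G \<longrightarrow> card (verts G) = n \<longrightarrow>
          free_of (cycle_graph 8) G \<longrightarrow>
          num_copies (cycle_graph 6) G \<ge> R n \<longrightarrow>
          (\<exists>a\<in>verts G. \<exists>b\<in>verts G. \<exists>c\<in>verts G.
             a \<noteq> b \<and> a \<noteq> c \<and> b \<noteq> c \<and>
             real (card (neighborhood G a \<inter> neighborhood G b \<inter> neighborhood G c))
               \<ge> (1 - \<delta>) * real n)))"
proof (intro allI impI)
  fix \<delta> :: real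
  assume "\<delta> > 0"
  \<comment> \<open>Capping at 1 keeps the threshold \<open>?\<beta>\<close> nonnegative.\<close>
  define d where "d = min \<delta> 1"
  have d: "0 < d" "d \<le> 1" "d \<le> \<delta>"
    using \<open>\<delta> > 0\<close> by (auto simp: d_def)
  \<comment> \<open>Makes \<open>K - 1\<close> at least \<open>4 / d\<close>, so that the factor
    \<open>K / (K - 1)\<close> raises the leading coefficient from \<open>1 - d / 2\<close> to at
    most \<open>1 - d / 4\<close>.\<close>
  define K where "K = 8 + nat \<lceil>4 / d\<rceil>"
  have "4 / d \<le> real (K - 1)"
    unfolding K_def by linarith
  then have K: "4 \<le> d * real (K - 1)"
    using d(1) by (simp only: pos_divide_le_eq mult.commute)
  have K1: "real K = real (K - 1) + 1"
    by (simp add: K_def)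
  let ?A = "240 * (real K)\<^sup>2" and ?B = "2432 * real K"
  obtain n1 where n1: "\<And>n. n \<ge> n1 \<Longrightarrow> ?A * ((real n)\<^sup>2 * sqrt (real n)) + ?B * (real n)\<^sup>2 +
      (1 - d / 4) * real n ^ 3 < (real n - 5) ^ 3"
    using eventually_less_cube[of "d / 4" ?A ?B] d(1) unfolding eventually_sequentially by auto
  show "\<exists>\<rho>::real. \<rho> > 0 \<and>
       (\<exists>n0::nat. \<forall>n\<ge>n0. \<forall>G::'a graph.
          simple_graph G \<longrightarrow> card (verts G) = n \<longrightarrow>
          free_of (cycle_graph 8) G \<longrightarrow>
          num_copies (cycle_graph 6) G \<ge> R n \<longrightarrow>
          (\<exists>a\<in>verts G. \<exists>b\<in>verts G. \<exists>c\<in>verts G.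
             a \<noteq> b \<and> a \<noteq> c \<and> b \<noteq> c \<and>
             real (card (neighborhood G a \<inter> neighborhood G b \<inter> neighborhood G c))
               \<ge> (1 - \<delta>) * real n))"
  \<comment> \<open>From 5 on the subtractions in \<open>R\<close> are exact and
    \<open>cube_le_R\<close> applies.\<close>
  proof (intro exI[of _ "1::real"] conjI exI[of _ "max n1 5"] allI impI)
    fix n :: nat and G :: "'a graph"
    assume n: "max n1 5 \<le> n" and G: "simple_graph G" "card (verts G) = n"
      "free_of (cycle_graph 8) G" and many: "R n \<le> num_copies (cycle_graph 6) G"
    interpret C8_free_graph_threshold G K
      by unfold_locales (use G in \<open>simp_all add: K_def\<close>)
    \<comment> \<open>Half of \<open>d\<close> is given up on each of two sides, since
      \<open>2 * ?\<beta> - real n\<close> is \<open>(1 - d) * real n\<close>.\<close>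
    let ?\<beta> = "(1 - d / 2) * real n"
    have "\<exists>a b c. fat_triangle a b c \<and>
        ?\<beta> \<le> real (codeg a b) \<and> ?\<beta> \<le> real (codeg b c) \<and> ?\<beta> \<le> real (codeg c a)"
    proof (rule ccontr)
      assume "\<not> ?thesis"
      then have small: "real (codeg a b) < ?\<beta> \<or> real (codeg b c) < ?\<beta> \<or> real (codeg c a) < ?\<beta>"
        if "fat_triangle a b c" for a b c
        using that by (meson not_le)
      have "0 \<le> ?\<beta>"
        using d by simp
      then have le: "real (K - 1) * real (num_copies (cycle_graph 6) G) \<le>
          real (K - 1) * (?A * ((real n)\<^sup>2 * sqrt (real n)) + ?B * (real n)\<^sup>2) +
          ?\<beta> * (real K * (real n)\<^sup>2)"
        using num_copies_C6_le[of ?\<beta>] small unfolding G(2) by blast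
      have "(1 - d / 2) * real K \<le> real (K - 1) * (1 - d / 4)"
      proof -
        have "(1 - d / 2) * (k + 1) \<le> k * (1 - d / 4)" if "4 \<le> d * k" for k
          using that d(1) by (simp add: algebra_simps)
        then show ?thesis
          unfolding K1 using K by blast
      qed
      then have "((1 - d / 2) * real K) * real n ^ 3 \<le> (real (K - 1) * (1 - d / 4)) * real n ^ 3"
        by (rule mult_right_mono) simp
      then have "?\<beta> * (real K * (real n)\<^sup>2) \<le> real (K - 1) * ((1 - d / 4) * real n ^ 3)"
        by (simp add: power2_eq_square power3_eq_cube mult_ac)
      with le have "real (K - 1) * real (num_copies (cycle_graph 6) G) \<le> real (K - 1) *
          (?A * ((real n)\<^sup>2 * sqrt (real n)) + ?B * (real n)\<^sup>2 + (1 - d / 4) * real n ^ 3)"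
        unfolding distrib_left by linarith
      moreover have "0 < real (K - 1)"
        by (simp add: K_def)
      ultimately have "real (num_copies (cycle_graph 6) G) \<le>
          ?A * ((real n)\<^sup>2 * sqrt (real n)) + ?B * (real n)\<^sup>2 + (1 - d / 4) * real n ^ 3"
        by (rule mult_left_le_imp_le)
      also have "\<dots> < (real n - 5) ^ 3"
        using n by (intro n1) simp
      also have "\<dots> \<le> real (R n)"
        using n by (intro cube_le_R) simp
      finally show False
        using many by simp
    qed
    then obtain a b c where abc: "fat_triangle a b c" "?\<beta> \<le> real (codeg a b)" "?\<beta> \<le> real (codeg b c)"
      by blast
    have "(1 - \<delta>) * real n \<le> (1 - d) * real n"
      using d by (intro mult_right_mono) simp_all
    also have "\<dots> = 2 * ?\<beta> - real n"
      by (simp add: algebra_simps)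
    also have "\<dots> \<le> real (card (N a \<inter> N b \<inter> N c))"
      using large_common_neighbourhood[OF abc] unfolding G(2) .
    finally have "(1 - \<delta>) * real n \<le> real (card (N a \<inter> N b \<inter> N c))" .
    moreover have "a \<in> V" "b \<in> V" "c \<in> V"
      using abc(1) fat_verts by (auto simp: fat_triangle_def)
    moreover have "a \<noteq> b" "a \<noteq> c" "b \<noteq> c"
      using fat_triangle_neq[OF abc(1)] by auto
    ultimately show "\<exists>a\<in>V. \<exists>b\<in>V. \<exists>c\<in>V. a \<noteq> b \<and> a \<noteq> c \<and> b \<noteq> c \<and>
        (1 - \<delta>) * real n \<le> real (card (N a \<inter> N b \<inter> N c))"
      by blast
  qed simp
qed

end
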